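(* Let $F$ be a simple graph of order $n\ge 1$, let $V_k=\{v_1,\ldots,v_k\}$ be a subset of the vertex set of $F$, and let $H_v$ be a simple graph of order $m\ge 2$ with a specified vertex $v$ of degree $m-1$. Let $H_1=H_v-v$ be an $r_1$-regular graph, where $r_1\ge 1$. Let $q\in\sigma(Q(H_v))\setminus\{\gamma,\delta\}$, where $\gamma,\delta$ are the roots of the equation $(x-2r_1-1)(x-m+1)-m+1=0$, and let $G=G[F,V_k,H_v]$. If $|V_k|=k$, then $q\in\sigma(Q(G))$ with multiplicity $k$. Moreover, the remaining $n+k$ $Q$-eigenvalues of $G$ are independent of $H_v$.
   Context: All graphs are finite and simple. For a graph $X$, $Q(X)=D(X)+A(X)$ is the signless Laplacian matrix, where $D(X)$ is the diagonal degree matrix and $A(X)$ the adjacency matrix; the $Q$-eigenvalues of $X$ are the eigenvalues of $Q(X)$, and $\sigma(Q(X))$ is the spectrum of $Q(X)$, consisting of all its eigenvalues. For a graph $X$ of order $s$, $q_1(X)\le\cdots\le q_s(X)$ denote the eigenvalues of $Q(X)$. Under the stated hypotheses, $\sigma(Q(H_v))=\{q_j(H_1)+1 : 1\le j\le m-2\}\cup\{\gamma,\delta\}$. Graph with $k$ pockets: $G[F,V_k,H_v]$ is the graph obtained by taking one copy of $F$ and $k$ vertex-disjoint copies of $H_v$, and then, for each $i=1,\ldots,k$, identifying the vertex $v$ of the $i$th copy of $H_v$ with the vertex $v_i$ of $F$. *)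

theory Defs
  imports
    "Graph_Theory.Pair_Digraph"
    "Jordan_Normal_Form.Char_Poly"
    "HOL-Library.Multiset"
begin

text \<open>A finite simple graph is a \<^locale>\<open>pair_graph\<close>: finitely many vertices, no loops, and a symmetric
  set of arcs, an edge being the pair of arcs \<open>(a, b)\<close>, \<open>(b, a)\<close>.  Hence the degree of a vertex
  is its \<^const>\<open>out_degree\<close>.\<close>

definition regular_graph :: "('a, 'b) pre_digraph \<Rightarrow> nat \<Rightarrow> bool" where
  "regular_graph X r \<longleftrightarrow> (\<forall>u \<in> verts X. out_degree X u = r)"

text \<open>Matrices are indexed by positions in a list \<open>xs\<close> that enumerates the vertices.\<close>

definition degree_matrix :: "'a pair_pre_digraph \<Rightarrow> 'a list \<Rightarrow> real mat" where
  "degree_matrix X xs = mat (length xs) (length xs)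
     (\<lambda>(i, j). if i = j then real (out_degree (with_proj X) (xs ! i)) else 0)"

definition adjacency_matrix :: "'a pair_pre_digraph \<Rightarrow> 'a list \<Rightarrow> real mat" where
  "adjacency_matrix X xs = mat (length xs) (length xs)
     (\<lambda>(i, j). if (xs ! i, xs ! j) \<in> parcs X then 1 else 0)"

definition signless_laplacian :: "'a pair_pre_digraph \<Rightarrow> 'a list \<Rightarrow> real mat" where
  "signless_laplacian X xs = degree_matrix X xs + adjacency_matrix X xs"

definition vertex_list :: "'a pair_pre_digraph \<Rightarrow> 'a list" where
  "vertex_list X = (SOME xs. distinct xs \<and> set xs = pverts X)"

text \<open>The multiset of \<open>Q\<close>-eigenvalues, with multiplicities. It does not depend on the chosen
  enumeration of the vertices, see \<open>Q_spectrum_eq\<close> below.\<close>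

definition Q_spectrum :: "'a pair_pre_digraph \<Rightarrow> real multiset" where
  "Q_spectrum X = proots (char_poly (signless_laplacian X (vertex_list X)))"

text \<open>\<open>H\<close> has order \<open>m\<close>, its vertex \<open>v\<close> has degree \<open>m - 1\<close>, and \<open>H - v\<close> is \<open>r\<close>-regular.\<close>

definition pocket :: "'h pair_pre_digraph \<Rightarrow> 'h \<Rightarrow> nat \<Rightarrow> nat \<Rightarrow> bool" where
  "pocket H v m r \<longleftrightarrow> pair_graph H \<and> card (pverts H) = m \<and> v \<in> pverts H \<and>
     out_degree (with_proj H) v = m - 1 \<and>
     regular_graph (pre_digraph.del_vert (with_proj H) v) r"

text \<open>The copy of \<open>H\<close> belonging to the vertex \<open>w\<close> of \<open>F\<close>: its vertex \<open>v\<close> is identified with \<open>w\<close>,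
  its other vertices \<open>x\<close> become the new vertices \<open>Inr (w, x)\<close>.\<close>

definition copy_vertex :: "'h \<Rightarrow> 'f \<Rightarrow> 'h \<Rightarrow> 'f + 'f \<times> 'h" where
  "copy_vertex v w x = (if x = v then Inl w else Inr (w, x))"

text \<open>The graph \<open>G[F, V, H]\<close>, with one copy of \<open>H\<close> for every vertex in \<open>V\<close>.\<close>

definition graph_with_pockets ::
    "'f pair_pre_digraph \<Rightarrow> 'f set \<Rightarrow> 'h pair_pre_digraph \<Rightarrow> 'h \<Rightarrow> ('f + 'f \<times> 'h) pair_pre_digraph"
  where
  "graph_with_pockets F V H v =
     \<lparr> pverts = Inl ` pverts F \<union> (\<Union>w \<in> V. copy_vertex v w ` pverts H),
       parcs = (\<lambda>(a, b). (Inl a, Inl b)) ` parcs F \<union>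
         (\<Union>w \<in> V. (\<lambda>(x, y). (copy_vertex v w x, copy_vertex v w y)) ` parcs H) \<rparr>"

text \<open>The \<open>Q\<close>-eigenvalues of \<open>H\<close> other than \<open>c\<close> and \<open>d\<close>. This is a difference of multisets:
  one occurrence of \<open>c\<close> and one of \<open>d\<close> are removed.  For example \<open>K\<^sub>3\<close> has the
  \<open>Q\<close>-eigenvalues \<open>1, 1, 4\<close> and \<open>{c, d} = {1, 4}\<close>, leaving one eigenvalue \<open>1\<close>.\<close>

definition pocket_eigenvalues :: "'h pair_pre_digraph \<Rightarrow> real \<Rightarrow> real \<Rightarrow> real multiset" where
  "pocket_eigenvalues H c d = Q_spectrum H - {#c, d#}"

definition remaining_eigenvalues ::
    "'f pair_pre_digraph \<Rightarrow> 'f set \<Rightarrow> 'h pair_pre_digraph \<Rightarrow> 'h \<Rightarrow> real \<Rightarrow> real \<Rightarrow> real multiset"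
  where
  "remaining_eigenvalues F V H v c d =
     Q_spectrum (graph_with_pockets F V H v) - repeat_mset (card V) (pocket_eigenvalues H c d)"

lemma signless_laplacian_carrier [simp]:
  "signless_laplacian X xs \<in> carrier_mat (length xs) (length xs)"
  unfolding signless_laplacian_def degree_matrix_def adjacency_matrix_def
  by (intro add_carrier_mat mat_carrier)

lemma signless_laplacian_index:
  assumes "i < length xs" "j < length xs"
  shows "signless_laplacian X xs $$ (i, j) =
    (if i = j then real (out_degree (with_proj X) (xs ! i)) else 0) +
    (if (xs ! i, xs ! j) \<in> parcs X then 1 else 0)"
  unfolding signless_laplacian_def degree_matrix_def adjacency_matrix_def
  using assms by simp

lemma char_poly_signless_laplacian_enumeration:
  assumes xs: "distinct xs" and ys: "distinct ys" and eq: "set xs = set ys"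
  shows "char_poly (signless_laplacian X xs) = char_poly (signless_laplacian X ys)"
proof -
  define n where "n = length xs"
  have ly: "length ys = n" using assms n_def by (metis distinct_card)
  define P where "P = mat n n (\<lambda>(i, j). if xs ! i = ys ! j then 1 else (0 :: real))"
  have ex: "\<exists>!j. j < n \<and> ys ! j = a" if "a \<in> set ys" for a
    using that ys ly by (metis distinct_Ex1)
  have ex': "\<exists>!j. j < n \<and> xs ! j = a" if "a \<in> set xs" for a
    using that xs n_def by (metis distinct_Ex1)
  define f where "f i = (THE j. j < n \<and> ys ! j = xs ! i)" for i
  define g where "g j = (THE i. i < n \<and> xs ! i = ys ! j)" for j
  have f: "f i < n \<and> ys ! f i = xs ! i" if "i < n" for i
    unfolding f_def
    by (rule theI'[OF ex]) (use that eq n_def nth_mem in metis)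
  have g: "g j < n \<and> xs ! g j = ys ! j" if "j < n" for j
    unfolding g_def
    by (rule theI'[OF ex']) (use that eq ly nth_mem in metis)
  have fE: "xs ! i = ys ! j \<longleftrightarrow> j = f i" if "i < n" "j < n" for i j
    using f[OF that(1)] that ys ly by (metis nth_eq_iff_index_eq)
  have gE: "xs ! i = ys ! j \<longleftrightarrow> i = g j" if "i < n" "j < n" for i j
    using g[OF that(2)] that xs n_def by (metis nth_eq_iff_index_eq)
  let ?A = "signless_laplacian X xs" and ?B = "signless_laplacian X ys"
  have A: "?A \<in> carrier_mat n n" and B: "?B \<in> carrier_mat n n"
    using signless_laplacian_carrier[of X xs] signless_laplacian_carrier[of X ys] n_def ly by simp_all
  have Pc: "P \<in> carrier_mat n n" by (simp add: P_def)
  have row: "(\<Sum>l<n. (if l = a then 1 else 0) * h l) = h a" if "a < n" for a and h :: "nat \<Rightarrow> real"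
  proof -
    have "(\<Sum>l<n. (if l = a then 1 else 0) * h l) = (\<Sum>l<n. if l = a then h l else 0)"
      by (rule sum.cong) auto
    then show ?thesis using that by simp
  qed
  have Pf: "P $$ (i, l) = (if l = f i then 1 else 0)"
    and Pg: "P $$ (i, l) = (if i = g l then 1 else 0)" if "i < n" "l < n" for i l
    using that fE gE by (auto simp: P_def)
  have PT: "P * transpose_mat P = 1\<^sub>m n"
  proof (rule eq_matI)
    fix i j assume "i < dim_row (1\<^sub>m n :: real mat)" "j < dim_col (1\<^sub>m n :: real mat)"
    then have ij: "i < n" "j < n" by auto
    have "(P * transpose_mat P) $$ (i, j) = (\<Sum>l<n. P $$ (i, l) * P $$ (j, l))"
      using ij Pc by (simp add: scalar_prod_def lessThan_atLeast0)
    also have "\<dots> = (\<Sum>l<n. (if l = f i then 1 else 0) * (if l = f j then 1 else 0))"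
      using ij by (intro sum.cong) (simp_all add: Pf)
    also have "\<dots> = (if f i = f j then 1 else 0)"
      using row[of "f i" "\<lambda>l. if l = f j then 1 else 0"] f[OF ij(1)] by simp
    also have "\<dots> = 1\<^sub>m n $$ (i, j)"
    proof -
      have "f i = f j \<longleftrightarrow> i = j"
        using f[OF ij(1)] f[OF ij(2)] ij xs n_def by (metis nth_eq_iff_index_eq)
      then show ?thesis using ij by simp
    qed
    finally show "(P * transpose_mat P) $$ (i, j) = 1\<^sub>m n $$ (i, j)" .
  qed (use Pc in auto)
  then have TP: "transpose_mat P * P = 1\<^sub>m n"
    using mat_mult_left_right_inverse[of P n "transpose_mat P"] Pc by simp
  have "?A * P = P * ?B"
  proof (rule eq_matI)
    fix i j assume "i < dim_row (P * ?B)" "j < dim_col (P * ?B)"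
    then have ij: "i < n" "j < n" using Pc B by auto
    have "(?A * P) $$ (i, j) = (\<Sum>l<n. P $$ (l, j) * ?A $$ (i, l))"
      using ij A Pc by (simp add: scalar_prod_def lessThan_atLeast0 mult.commute)
    also have "\<dots> = (\<Sum>l<n. (if l = g j then 1 else 0) * ?A $$ (i, l))"
      using ij by (intro sum.cong) (simp_all add: Pg)
    also have "\<dots> = ?A $$ (i, g j)" using g[OF ij(2)] by (intro row) simp
    also have "\<dots> = ?B $$ (f i, j)"
    proof -
      have "i = g j \<longleftrightarrow> f i = j" using fE[OF ij] gE[OF ij] by auto
      then show ?thesis
        using f[OF ij(1)] g[OF ij(2)] ij n_def ly by (auto simp: signless_laplacian_index)
    qed
    also have "\<dots> = (\<Sum>l<n. (if l = f i then 1 else 0) * ?B $$ (l, j))"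
      using row[of "f i" "\<lambda>l. ?B $$ (l, j)"] f[OF ij(1)] by simp
    also have "\<dots> = (\<Sum>l<n. P $$ (i, l) * ?B $$ (l, j))"
      using ij by (intro sum.cong) (simp_all add: Pf)
    also have "\<dots> = (P * ?B) $$ (i, j)"
      using ij B Pc by (simp add: scalar_prod_def lessThan_atLeast0)
    finally show "(?A * P) $$ (i, j) = (P * ?B) $$ (i, j)" .
  qed (use A B Pc in auto)
  then have "P * ?B * transpose_mat P = ?A * (P * transpose_mat P)"
    using A Pc by (metis assoc_mult_mat transpose_carrier_mat)
  then have "?A = P * ?B * transpose_mat P" using PT A by simp
  then have "similar_mat ?A ?B"
    using PT TP A B Pc by (intro similar_matI[of _ _ P "transpose_mat P" n]) auto
  then show ?thesis by (rule char_poly_similar)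
qed

lemma Q_spectrum_eq:
  assumes "distinct xs" "set xs = pverts X"
  shows "Q_spectrum X = proots (char_poly (signless_laplacian X xs))"
proof -
  have "distinct (vertex_list X) \<and> set (vertex_list X) = pverts X"
    unfolding vertex_list_def by (rule someI[of _ xs]) (use assms in simp)
  then show ?thesis
    unfolding Q_spectrum_def using assms char_poly_signless_laplacian_enumeration by metis
qed

lemma pair_graph_graph_with_pockets:
  assumes "pair_graph F" "pair_graph H" "V \<subseteq> pverts F"
  shows "pair_graph (graph_with_pockets F V H v)"
proof -
  interpret F: pair_graph F by fact
  interpret H: pair_graph H by fact
  have fV: "finite V" using assms(3) F.pair_finite_verts finite_subset by blast
  have sF: "sym (parcs F)" and sH: "sym (parcs H)"
    using F.sym_arcs H.sym_arcs by (simp_all add: symmetric_def)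
  show ?thesis
  proof
    fix e assume e: "e \<in> parcs (graph_with_pockets F V H v)"
    have "fst e \<in> pverts (graph_with_pockets F V H v) \<and> snd e \<in> pverts (graph_with_pockets F V H v)"
    proof -
      consider x y where "(x, y) \<in> parcs F" "e = (Inl x, Inl y)"
        | w x y where "w \<in> V" "(x, y) \<in> parcs H" "e = (copy_vertex v w x, copy_vertex v w y)"
        using e by (auto simp: graph_with_pockets_def)
      then show ?thesis
      proof cases
        case 1
        then show ?thesis using F.wellformed'[of x y] by (simp add: graph_with_pockets_def)
      next
        case 2
        then have "copy_vertex v w x \<in> copy_vertex v w ` pverts H"
          "copy_vertex v w y \<in> copy_vertex v w ` pverts H"
          using H.wellformed'[of x y] by blast+
        with 2 show ?thesis by (auto simp: graph_with_pockets_def)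
      qed
    qed
    then show "fst e \<in> pverts (graph_with_pockets F V H v)"
      "snd e \<in> pverts (graph_with_pockets F V H v)" by blast+
    show "fst e \<noteq> snd e"
      using e by (auto simp: graph_with_pockets_def copy_vertex_def split: if_splits
          dest: F.no_loops' H.no_loops')
  next
    show "finite (pverts (graph_with_pockets F V H v))" "finite (parcs (graph_with_pockets F V H v))"
      using fV F.pair_finite_verts F.pair_finite_arcs H.pair_finite_verts H.pair_finite_arcs
      by (auto simp: graph_with_pockets_def)
    show "symmetric (with_proj (graph_with_pockets F V H v))"
    proof -
      have "sym (parcs (graph_with_pockets F V H v))"
      proof (rule symI)
        fix a b assume "(a, b) \<in> parcs (graph_with_pockets F V H v)"
        then consider x y where "(x, y) \<in> parcs F" "a = Inl x" "b = Inl y"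
          | w x y where "w \<in> V" "(x, y) \<in> parcs H" "a = copy_vertex v w x" "b = copy_vertex v w y"
          by (auto simp: graph_with_pockets_def)
        then show "(b, a) \<in> parcs (graph_with_pockets F V H v)"
        proof cases
          case 1
          then show ?thesis using symD[OF sF] by (force simp: graph_with_pockets_def)
        next
          case 2
          then have "(y, x) \<in> parcs H" using symD[OF sH] by blast
          with 2 show ?thesis by (force simp: graph_with_pockets_def)
        qed
      qed
      then show ?thesis by (simp add: symmetric_def)
    qed
  qed
qed

end

theory Submission
  imports Defs
begin

text \<open>Let \<open>c = 2 r + 1\<close>. The rows of \<open>x - Q(H)\<close> restricted to \<open>H - v\<close> all sum to \<open>x - c\<close>, so adding
  \<open>1 / (x - c)\<close> times the columns of a copy of \<open>H - v\<close> to the column of the vertex that it is attached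
  to clears the block below that vertex; only its diagonal entry changes, by \<open>- (m - 1) / (x - c)\<close>.
  Applied to \<open>H\<close> alone this shows that the characteristic polynomial of the block of \<open>H - v\<close> is
  \<open>(x - c) g\<close>, where \<open>(x - \<gamma>) (x - \<delta>) g\<close> is that of \<open>Q(H)\<close>. Applied to \<open>G[F, V, H]\<close> it gives
  \<open>((x - c) g)\<^sup>k R\<close> with a rational function \<open>R\<close> that depends only on \<open>F\<close>, \<open>V\<close>, \<open>m\<close> and \<open>r\<close>. The
  same computation, with a single vertex in place of \<open>H - v\<close>, identifies \<open>(x - c)\<^sup>k R\<close> as the
  characteristic polynomial of a matrix of order \<open>n + k\<close>. Its roots are all real because the
  characteristic polynomials of the symmetric matrices \<open>Q(G)\<close> and \<open>Q(H)\<close> split over the reals.\<close>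

section \<open>Eigenvalues of real symmetric matrices\<close>

text \<open>Over the complex numbers the characteristic polynomial splits. For an eigenvector
  \<open>w\<close> with eigenvalue \<open>c\<close>, moving the symmetric matrix across the
  Hermitian product gives \<open>c = cnj c\<close>, so every linear factor is already real.\<close>

lemma symmetric_real_char_poly_splits:
  fixes A :: "real mat"
  assumes A: "A \<in> carrier_mat n n" and sym: "transpose_mat A = A"
  obtains as where "char_poly A = (\<Prod>a\<leftarrow>as. [:- a, 1:])" "length as = n"
proof -
  interpret of_real_poly_hom: map_poly_comm_ring_hom complex_of_real ..
  define B where "B = map_mat complex_of_real A"
  have B: "B \<in> carrier_mat n n" using A by (simp add: B_def)
  have cB: "char_poly B = map_poly complex_of_real (char_poly A)"
    unfolding B_def by (rule of_real_hom.char_poly_hom[OF A])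
  obtain cs where cs: "char_poly B = (\<Prod>c\<leftarrow>cs. [:- c, 1:])" "length cs = n"
    using char_poly_factorized[OF B] by blast
  have "complex_of_real (Re c) = c" if "c \<in> set cs" for c
  proof -
    have "poly (char_poly B) c = 0"
      using that unfolding cs(1) by (auto simp: poly_prod_list prod_list_zero_iff)
    then have "eigenvalue B c" using eigenvalue_root_char_poly[OF B] by simp
    then obtain w where w: "w \<in> carrier_vec n" "w \<noteq> 0\<^sub>v n" "B *\<^sub>v w = c \<cdot>\<^sub>v w"
      using B by (auto simp: eigenvalue_def eigenvector_def)
    have cw: "conjugate w \<in> carrier_vec n" using w(1) by simp
    have symB: "transpose_mat B = B" using sym by (simp add: B_def map_mat_transpose)
    \<comment> \<open>The entries of \<open>B\<close> are real, so multiplication by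
      \<open>B\<close> commutes with conjugation.\<close>
    have conjB: "B *\<^sub>v conjugate w = conjugate (B *\<^sub>v w)"
      using A w(1) by (intro eq_vecI) (auto simp: B_def scalar_prod_def)
    have "c * (w \<bullet>c w) = (B *\<^sub>v w) \<bullet>c w"
      using w(1) cw by (simp add: w(3))
    also have "\<dots> = w \<bullet> (B *\<^sub>v conjugate w)"
      using transpose_vec_mult_scalar[OF B cw w(1)] symB by simp
    also have "\<dots> = cnj c * (w \<bullet>c w)"
      using w(1) cw unfolding conjB w(3) by (simp add: conjugate_smult_vec)
    finally have "c = cnj c" using w(1,2) by simp
    then show ?thesis by (simp add: complex_eq_iff)
  qed
  then have "map (\<lambda>c. [:- c, 1:]) cs =
      map (map_poly complex_of_real) (map (\<lambda>a. [:- a, 1:]) (map Re cs))"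
    by (simp add: map_poly_pCons)
  then have "char_poly B = map_poly complex_of_real (\<Prod>a\<leftarrow>map Re cs. [:- a, 1:])"
    unfolding cs(1) of_real_poly_hom.hom_prod_list by (simp only:)
  then have "map_poly complex_of_real (char_poly A) = map_poly complex_of_real (\<Prod>a\<leftarrow>map Re cs. [:- a, 1:])"
    using cB by simp
  then have "char_poly A = (\<Prod>a\<leftarrow>map Re cs. [:- a, 1:])"
    by (simp add: poly_eq_iff coeff_map_poly)
  then show ?thesis using cs(2) that[of "map Re cs"] by simp
qed

text \<open>Each of the \<open>n\<close> linear factors contributes one root. Knowing this number is
  enough to count the remaining \<open>Q\<close>-eigenvalues at the end.\<close>

lemma size_proots_symmetric_real:
  fixes A :: "real mat"
  assumes A: "A \<in> carrier_mat n n" and sym: "transpose_mat A = A"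
  shows "size (proots (char_poly A)) = n"
proof -
  obtain as where as: "char_poly A = (\<Prod>a\<leftarrow>as. [:- a, 1:])" "length as = n"
    using symmetric_real_char_poly_splits[OF assms] .
  have "size (proots (\<Prod>a\<leftarrow>as. [:- a, 1:])) = length as" for as :: "real list"
    by (induction as) (simp_all add: proots_mult prod_list_zero_iff image_iff del: mult_pCons_left)
  then show ?thesis using as by simp
qed

section \<open>Matrices indexed by lists and block elimination\<close>

text \<open>Entries depend on list elements rather than positions, so appending lists corresponds to
  forming block matrices.\<close>

definition list_mat :: "('a \<Rightarrow> 'a \<Rightarrow> 'b) \<Rightarrow> 'a list \<Rightarrow> 'b mat" where
  "list_mat M xs = mat (length xs) (length xs) (\<lambda>(i, j). M (xs ! i) (xs ! j))"

lemma list_mat_carrier [simp]: "list_mat M xs \<in> carrier_mat (length xs) (length xs)"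
  by (simp add: list_mat_def)

lemma list_mat_cong:
  assumes "\<And>a b. a \<in> set xs \<Longrightarrow> b \<in> set xs \<Longrightarrow> M a b = N a b"
  shows "list_mat M xs = list_mat N xs"
  using assms by (intro eq_matI) (auto simp: list_mat_def)

lemma list_mat_map: "list_mat M (map f xs) = list_mat (\<lambda>a b. M (f a) (f b)) xs"
  by (intro eq_matI) (auto simp: list_mat_def)

text \<open>Evaluation at a scalar \<open>x\<close> yields a determinant of scalars, in which
  division by \<open>x - c\<close> is possible. Distinctness makes equality of elements mean
  equality of positions.\<close>

lemma poly_char_poly_list_mat:
  fixes M :: "'a \<Rightarrow> 'a \<Rightarrow> 'b :: comm_ring_1"
  assumes "distinct xs"
  shows "poly (char_poly (list_mat M xs)) x =
    det (list_mat (\<lambda>a b. (if a = b then x else 0) - M a b) xs)"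
  unfolding char_poly_def
  by (rule poly_det_cong[of _ "length xs"])
    (use assms in \<open>auto simp: char_poly_matrix_def list_mat_def nth_eq_iff_index_eq\<close>)

text \<open>The function \<open>C\<close> describes column operations that clear the lower left block.\<close>

lemma det_list_mat_append:
  fixes M :: "'a \<Rightarrow> 'a \<Rightarrow> 'b :: idom"
  assumes "\<And>y b. y \<in> set ys \<Longrightarrow> b \<in> set xs \<Longrightarrow> M y b + (\<Sum>z\<leftarrow>ys. M y z * C z b) = 0"
  shows "det (list_mat M (xs @ ys)) =
    det (list_mat (\<lambda>a b. M a b + (\<Sum>z\<leftarrow>ys. M a z * C z b)) xs) * det (list_mat M ys)"
proof -
  let ?n = "length xs" and ?m = "length ys"
  define B where "B = mat ?n ?m (\<lambda>(i, j). M (xs ! i) (ys ! j))"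
  define E where "E = mat ?m ?n (\<lambda>(i, j). M (ys ! i) (xs ! j))"
  define K where "K = mat ?m ?n (\<lambda>(i, j). C (ys ! i) (xs ! j))"
  let ?A = "list_mat M xs" and ?D = "list_mat M ys"
  \<comment> \<open>Right multiplication by \<open>?T\<close> performs the column operations; being
    unit lower triangular, it leaves the determinant unchanged.\<close>
  let ?T = "four_block_mat (1\<^sub>m ?n) (0\<^sub>m ?n ?m) K (1\<^sub>m ?m)"
  have c: "B \<in> carrier_mat ?n ?m" "E \<in> carrier_mat ?m ?n" "K \<in> carrier_mat ?m ?n"
    by (simp_all add: B_def E_def K_def)
  have split: "list_mat M (xs @ ys) = four_block_mat ?A B E ?D"
    by (intro eq_matI) (auto simp: list_mat_def B_def E_def nth_append)
  have T: "?T \<in> carrier_mat (?n + ?m) (?n + ?m)" using c by simp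
  have detT: "det ?T = 1"
    using det_four_block_mat_upper_right_zero[OF one_carrier_mat refl c(3) one_carrier_mat] by simp
  have ul: "?A * 1\<^sub>m ?n + B * K = list_mat (\<lambda>a b. M a b + (\<Sum>z\<leftarrow>ys. M a z * C z b)) xs"
    using c by (intro eq_matI)
      (auto simp: list_mat_def B_def K_def scalar_prod_def sum_list_sum_nth)
  have ll: "E * 1\<^sub>m ?n + ?D * K = 0\<^sub>m ?m ?n"
    using c assms by (intro eq_matI)
      (auto simp: list_mat_def E_def K_def scalar_prod_def sum_list_sum_nth)
  have "four_block_mat ?A B E ?D * ?T =
      four_block_mat (list_mat (\<lambda>a b. M a b + (\<Sum>z\<leftarrow>ys. M a z * C z b)) xs) B (0\<^sub>m ?m ?n) ?D"
    unfolding mult_four_block_mat[OF list_mat_carrier c(1,2) list_mat_carrier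
        one_carrier_mat zero_carrier_mat c(3) one_carrier_mat] ul ll
    using c right_mult_zero_mat[OF list_mat_carrier[of M xs]]
      right_mult_one_mat[OF list_mat_carrier[of M ys]] left_add_zero_mat[OF list_mat_carrier[of M ys]]
    by simp
  moreover have "four_block_mat ?A B E ?D \<in> carrier_mat (?n + ?m) (?n + ?m)" by simp
  ultimately have "det (list_mat M (xs @ ys)) * det ?T =
      det (four_block_mat (list_mat (\<lambda>a b. M a b + (\<Sum>z\<leftarrow>ys. M a z * C z b)) xs) B (0\<^sub>m ?m ?n) ?D)"
    unfolding split using det_mult[OF _ T, of "four_block_mat ?A B E ?D"] by (simp only:)
  then show ?thesis
    by (simp only: detT mult_1_right
        det_four_block_mat_lower_left_zero[OF list_mat_carrier c(1) refl list_mat_carrier])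
qed

section \<open>Determinants of matrices with pocket structure\<close>

text \<open>\<open>P\<close> is the block of the base graph, \<open>D\<close> the block repeated for
  each copy, \<open>u\<close> and \<open>l\<close> the coupling of a copy to its base vertex. The
  type of the copies is left open: it is instantiated with the vertices of \<open>H\<close> and with
  a single point.\<close>

fun pocket_entry ::
    "('f \<Rightarrow> 'f \<Rightarrow> 'b) \<Rightarrow> ('c \<Rightarrow> 'c \<Rightarrow> 'b) \<Rightarrow> ('c \<Rightarrow> 'b) \<Rightarrow> ('c \<Rightarrow> 'b)
      \<Rightarrow> 'f + 'f \<times> 'c \<Rightarrow> 'f + 'f \<times> 'c \<Rightarrow> 'b :: zero" where
  "pocket_entry P D u l (Inl a) (Inl b) = P a b"
| "pocket_entry P D u l (Inl a) (Inr (w, h)) = (if a = w then u h else 0)"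
| "pocket_entry P D u l (Inr (w, h)) (Inl b) = (if w = b then l h else 0)"
| "pocket_entry P D u l (Inr (w, h)) (Inr (w', h')) = (if w = w' then D h h' else 0)"

definition pocket_list :: "'f list \<Rightarrow> 'f list \<Rightarrow> 'c list \<Rightarrow> ('f + 'f \<times> 'c) list" where
  "pocket_list xs vs hs = map Inl xs @ concat (map (\<lambda>w. map (\<lambda>h. Inr (w, h)) hs) vs)"

lemma set_pocket_list: "set (pocket_list xs vs hs) = Inl ` set xs \<union> Inr ` (set vs \<times> set hs)"
  by (auto simp: pocket_list_def)

lemma distinct_pocket_list:
  assumes "distinct xs" "distinct vs" "distinct hs"
  shows "distinct (pocket_list xs vs hs)"
proof -
  have "distinct (concat (map (\<lambda>w. map (\<lambda>h. Inr (w, h)) hs) vs) :: ('a + 'a \<times> 'b) list)"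
    using assms(2,3) by (induction vs) (auto simp: distinct_map inj_on_def)
  then show ?thesis
    using assms(1) by (auto simp: pocket_list_def distinct_map)
qed

text \<open>Adding \<open>- c / s\<close> times all columns of a copy to the column of its base
  vertex clears the entries \<open>c\<close> below, because the rows of \<open>D\<close> sum to
  \<open>s\<close>. Each copy then splits off a factor \<open>det D\<close> and only changes one
  diagonal entry of \<open>P\<close>.\<close>

lemma det_pocket_entry:
  fixes P :: "'f \<Rightarrow> 'f \<Rightarrow> 'b :: field" and D :: "'c \<Rightarrow> 'c \<Rightarrow> 'b"
  assumes s: "s \<noteq> 0" "\<And>h. h \<in> set hs \<Longrightarrow> (\<Sum>z\<leftarrow>hs. D h z) = s"
    and l: "\<And>h. h \<in> set hs \<Longrightarrow> l h = c"
    and "distinct vs"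
  shows "det (list_mat (pocket_entry P D u l) (pocket_list xs vs hs)) =
    det (list_mat D hs) ^ length vs *
    det (list_mat (\<lambda>a b. P a b - (if a = b \<and> a \<in> set vs then c * (\<Sum>z\<leftarrow>hs. u z) / s else 0)) xs)"
  using \<open>distinct vs\<close>
\<comment> \<open>The last copy is a suffix of \<open>pocket_list\<close>, hence the induction from
  the right; \<open>P\<close> varies because each elimination alters it.\<close>
proof (induction vs arbitrary: P rule: rev_induct)
  case Nil
  then show ?case by (simp add: pocket_list_def list_mat_map)
next
  case (snoc w vs)
  let ?ys = "map (\<lambda>h. Inr (w, h)) hs :: ('f + 'f \<times> 'c) list"
  let ?M = "pocket_entry P D u l"
  define C :: "'f + 'f \<times> 'c \<Rightarrow> 'f + 'f \<times> 'c \<Rightarrow> 'b" where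
    "C z b = (if b = Inl w then - c / s else 0)" for z b
  define P' where "P' a b = P a b - (if a = b \<and> a = w then c * (\<Sum>z\<leftarrow>hs. u z) / s else 0)" for a b
  have list: "pocket_list xs (vs @ [w]) hs = pocket_list xs vs hs @ ?ys"
    by (simp add: pocket_list_def)
  have clear: "?M y b + (\<Sum>z\<leftarrow>?ys. ?M y z * C z b) = 0"
    if y: "y \<in> set ?ys" and b: "b \<in> set (pocket_list xs vs hs)" for y b
  proof -
    obtain h where h: "h \<in> set hs" "y = Inr (w, h)" using y by auto
    consider a where "b = Inl a" | w' h' where "b = Inr (w', h')" "w' \<in> set vs"
      using b by (auto simp: set_pocket_list)
    then show ?thesis
    proof cases
      case 1
      have "(\<Sum>z\<leftarrow>hs. D h z * (- c / s)) = - c"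
        unfolding sum_list_mult_const using s h(1) by simp
      then show ?thesis using 1 h l by (simp add: C_def o_def)
    next
      case 2
      then show ?thesis using h snoc.prems by (auto simp: C_def o_def)
    qed
  qed
  \<comment> \<open>As \<open>w\<close> does not occur in \<open>vs\<close>, the row of
    \<open>Inl w\<close> is the only remaining one that meets the columns of this copy.\<close>
  have reduced: "?M a b + (\<Sum>z\<leftarrow>?ys. ?M a z * C z b) = pocket_entry P' D u l a b"
    if a: "a \<in> set (pocket_list xs vs hs)" for a b
  proof -
    have "(\<Sum>z\<leftarrow>?ys. ?M a z * C z b) =
        (\<Sum>h\<leftarrow>hs. ?M a (Inr (w, h))) * (if b = Inl w then - c / s else 0)"
      by (simp add: o_def C_def sum_list_mult_const del: mult_minus_right times_divide_eq_right)
    moreover have "(\<Sum>h\<leftarrow>hs. ?M a (Inr (w, h))) =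
        (if a = Inl w then \<Sum>h\<leftarrow>hs. u h else 0)"
    proof (cases a)
      case (Inr p)
      then obtain w' h where "a = Inr (w', h)" "w' \<noteq> w"
        by (cases p) (use a snoc.prems in \<open>auto simp: set_pocket_list\<close>)
      then show ?thesis by simp
    qed simp
    moreover have "pocket_entry P' D u l a b = ?M a b -
        (if a = Inl w \<and> b = Inl w then c * (\<Sum>z\<leftarrow>hs. u z) / s else 0)"
      by (cases "(P, D, u, l, a, b)" rule: pocket_entry.cases) (auto simp: P'_def)
    ultimately show ?thesis by (cases "a = Inl w"; cases "b = Inl w") simp_all
  qed
  have "det (list_mat ?M (pocket_list xs (vs @ [w]) hs)) =
      det (list_mat (\<lambda>a b. ?M a b + (\<Sum>z\<leftarrow>?ys. ?M a z * C z b)) (pocket_list xs vs hs)) *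
      det (list_mat ?M ?ys)"
    unfolding list by (rule det_list_mat_append) (rule clear)
  also have "list_mat (\<lambda>a b. ?M a b + (\<Sum>z\<leftarrow>?ys. ?M a z * C z b)) (pocket_list xs vs hs) =
      list_mat (pocket_entry P' D u l) (pocket_list xs vs hs)"
    by (rule list_mat_cong) (rule reduced)
  also have "list_mat ?M ?ys = list_mat D hs" by (simp add: list_mat_map)
  also have "det (list_mat (pocket_entry P' D u l) (pocket_list xs vs hs)) =
      det (list_mat D hs) ^ length vs *
      det (list_mat (\<lambda>a b. P' a b - (if a = b \<and> a \<in> set vs then c * (\<Sum>z\<leftarrow>hs. u z) / s else 0)) xs)"
    using snoc by simp
  also have "list_mat (\<lambda>a b. P' a b - (if a = b \<and> a \<in> set vs then c * (\<Sum>z\<leftarrow>hs. u z) / s else 0)) xs =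
      list_mat (\<lambda>a b. P a b - (if a = b \<and> a \<in> set (vs @ [w]) then c * (\<Sum>z\<leftarrow>hs. u z) / s else 0)) xs"
    using snoc.prems by (intro list_mat_cong) (auto simp: P'_def)
  finally show ?case by simp
qed

section \<open>Degrees and row sums in a pocket\<close>

definition adj :: "'a pair_pre_digraph \<Rightarrow> 'a \<Rightarrow> 'a \<Rightarrow> real" where
  "adj X a b = (if (a, b) \<in> parcs X then 1 else 0)"

definition q_entry :: "'a pair_pre_digraph \<Rightarrow> 'a \<Rightarrow> 'a \<Rightarrow> real" where
  "q_entry X a b = (if a = b then real (out_degree (with_proj X) a) else 0) + adj X a b"

lemma signless_laplacian_list_mat:
  assumes "distinct xs"
  shows "signless_laplacian X xs = list_mat (q_entry X) xs"
  using assms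
  by (intro eq_matI)
    (auto simp: list_mat_def signless_laplacian_index q_entry_def adj_def nth_eq_iff_index_eq
      carrier_matD[OF signless_laplacian_carrier])

text \<open>The set \<open>S\<close> is all of \<open>pverts X\<close> for the degree in
  \<open>X\<close>, and \<open>pverts H - {v}\<close> for the degree after deleting
  \<open>v\<close>.\<close>

lemma real_card_arcs:
  assumes "finite S"
  shows "real (card {e \<in> parcs X. fst e = a \<and> snd e \<in> S}) = (\<Sum>b\<in>S. adj X a b)"
proof -
  have "{e \<in> parcs X. fst e = a \<and> snd e \<in> S} = Pair a ` {b \<in> S. (a, b) \<in> parcs X}"
    by auto
  then have "card {e \<in> parcs X. fst e = a \<and> snd e \<in> S} = card {b \<in> S. (a, b) \<in> parcs X}"
    by (simp add: card_image inj_on_def)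
  then show ?thesis
    using assms by (simp add: adj_def sum.If_cases Int_def)
qed

lemma real_out_degree:
  assumes "pair_graph X"
  shows "real (out_degree (with_proj X) a) = (\<Sum>b\<in>pverts X. adj X a b)"
proof -
  interpret pair_graph X by fact
  have "out_arcs (with_proj X) a = {e \<in> parcs X. fst e = a \<and> snd e \<in> pverts X}"
    using in_arcsD2 by (fastforce simp: out_arcs_def)
  then show ?thesis
    using real_card_arcs[of "pverts X" X a] by (simp add: out_degree_def)
qed

text \<open>\<open>Q_spectrum\<close> collects real roots only; symmetry of the signless Laplacian
  ensures that none is lost.\<close>

lemma size_Q_spectrum:
  assumes "pair_graph X"
  shows "size (Q_spectrum X) = card (pverts X)"
proof -
  interpret pair_graph X by fact
  obtain xs where xs: "distinct xs" "set xs = pverts X"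
    using finite_distinct_list[OF pair_finite_verts] by blast
  have "(a, b) \<in> parcs X \<longleftrightarrow> (b, a) \<in> parcs X" for a b
    using sym_arcs by (auto simp: symmetric_def dest: symD)
  then have "q_entry X a b = q_entry X b a" for a b
    by (simp add: q_entry_def adj_def)
  then have "transpose_mat (list_mat (q_entry X) xs) = list_mat (q_entry X) xs"
    by (intro eq_matI) (auto simp: list_mat_def)
  then have "size (proots (char_poly (list_mat (q_entry X) xs))) = length xs"
    by (rule size_proots_symmetric_real[OF list_mat_carrier])
  then show ?thesis
    using Q_spectrum_eq[OF xs] xs distinct_card[OF xs(1)] by (simp add: signless_laplacian_list_mat)
qed

text \<open>The degree of \<open>v\<close> equals the number of other vertices, so the nonnegative
  deficits \<open>1 - adj H v b\<close> sum to zero and each of them vanishes.\<close>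

lemma pocket_arcs:
  assumes "pocket H v m r" "h \<in> pverts H" "h \<noteq> v"
  shows "adj H v h = 1" "adj H h v = 1"
proof -
  interpret pair_graph H using assms(1) by (simp add: pocket_def)
  have deg: "real (card (pverts H - {v})) = real (out_degree (with_proj H) v)"
    using assms(1) by (simp add: pocket_def)
  have loop: "adj H v v = 0" using no_loops' by (auto simp: adj_def)
  have "(\<Sum>b\<in>pverts H. adj H v b) = (\<Sum>b\<in>pverts H - {v}. adj H v b)"
    using loop by (intro sum.mono_neutral_right) auto
  then have "(\<Sum>b\<in>pverts H - {v}. 1 - adj H v b) = 0"
    using deg real_out_degree[OF pair_graph_axioms, of v] by (simp add: sum_subtractf)
  then have "\<forall>b\<in>pverts H - {v}. 1 - adj H v b = 0"
    by (subst (asm) sum_nonneg_eq_0_iff) (auto simp: adj_def)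
  then show "adj H v h = 1" using assms(2,3) by simp
  then have "(v, h) \<in> parcs H" by (simp add: adj_def split: if_splits)
  then have "(h, v) \<in> parcs H" using sym_arcs by (auto simp: symmetric_def dest: symD)
  then show "adj H h v = 1" by (simp add: adj_def)
qed

lemma pocket_regular:
  assumes "pocket H v m r" "h \<in> pverts H" "h \<noteq> v"
  shows "(\<Sum>z\<in>pverts H - {v}. adj H h z) = real r" "real (out_degree (with_proj H) h) = real r + 1"
proof -
  interpret pair_graph H using assms(1) by (simp add: pocket_def)
  have "out_arcs (pre_digraph.del_vert (with_proj H) v) h =
      {e \<in> parcs H. fst e = h \<and> snd e \<in> pverts H - {v}}"
    using in_arcsD2 assms(3) by (fastforce simp: out_arcs_def pre_digraph.del_vert_def)
  moreover have "out_degree (pre_digraph.del_vert (with_proj H) v) h = r"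
    using assms by (simp add: pocket_def regular_graph_def pre_digraph.verts_del_vert)
  ultimately show r: "(\<Sum>z\<in>pverts H - {v}. adj H h z) = real r"
    using real_card_arcs[of "pverts H - {v}" H h] by (simp add: out_degree_def)
  have "v \<in> pverts H" using assms(1) by (simp add: pocket_def)
  then show "real (out_degree (with_proj H) h) = real r + 1"
    using r real_out_degree[OF pair_graph_axioms, of h] pocket_arcs(2)[OF assms]
      sum.remove[of "pverts H" v "adj H h"] by simp
qed

text \<open>The diagonal contributes \<open>x - (r + 1)\<close>, since \<open>h\<close> has
  \<open>r\<close> neighbours besides \<open>v\<close>, and these neighbours contribute
  \<open>- r\<close>.\<close>

lemma pocket_row_sum:
  assumes "pocket H v m r" "distinct hs" "set hs = pverts H - {v}" "h \<in> set hs"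
  shows "(\<Sum>z\<leftarrow>hs. (if h = z then x else 0) - q_entry H h z) = x - (2 * real r + 1)"
proof -
  have h: "h \<in> pverts H" "h \<noteq> v" using assms(3,4) by auto
  have fin: "finite (pverts H - {v})" unfolding assms(3)[symmetric] by simp
  have "(\<Sum>z\<leftarrow>hs. (if h = z then x else 0) - q_entry H h z) =
      (\<Sum>z\<in>pverts H - {v}. (if h = z then x - (real r + 1) else 0) - adj H h z)"
    unfolding sum_list_distinct_conv_sum_set[OF assms(2)] assms(3)
    by (rule sum.cong) (use pocket_regular(2)[OF assms(1) h] in \<open>auto simp: q_entry_def\<close>)
  also have "\<dots> = x - (real r + 1) - real r"
    using fin h by (simp add: sum_subtractf pocket_regular(1)[OF assms(1) h])
  finally show ?thesis by simp
qed

section \<open>The spectrum of a single pocket\<close>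

text \<open>Multiplying by \<open>X - c\<close> makes both sides agree everywhere. This removes the
  exclusion of \<open>x = c\<close> forced by dividing by \<open>x - c\<close>.\<close>

lemma poly_eq_off_point:
  fixes p q :: "'a :: {idom, ring_char_0} poly"
  assumes "\<And>x. x \<noteq> c \<Longrightarrow> poly p x = poly q x"
  shows "p = q"
proof -
  have "poly (p * [:- c, 1:]) x = poly (q * [:- c, 1:]) x" for x
    using assms[of x] by (cases "x = c") auto
  then have "p * [:- c, 1:] = q * [:- c, 1:]"
    by (simp add: poly_eq_poly_eq_iff[symmetric] fun_eq_iff)
  then show ?thesis by (simp del: mult_pCons_right)
qed

text \<open>A set of roots carries no multiplicities, so the sum of the roots needs an argument when
  \<open>\<gamma> = \<delta>\<close>: with \<open>\<gamma>\<close>, also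
  \<open>b + e - \<gamma>\<close> is a root.\<close>

lemma pocket_quadratic_roots:
  fixes b e \<gamma> \<delta> :: real
  assumes "e > 0" "{x. (x - b) * (x - e) - e = 0} = {\<gamma>, \<delta>}"
  shows "(x - b) * (x - e) - e = (x - \<gamma>) * (x - \<delta>)"
proof -
  have \<gamma>: "(\<gamma> - b) * (\<gamma> - e) - e = 0" and \<delta>: "(\<delta> - b) * (\<delta> - e) - e = 0"
    using assms(2) by blast+
  have "\<gamma> + \<delta> = b + e"
  proof (cases "\<gamma> = \<delta>")
    case True
    have "(b + e - \<gamma> - b) * (b + e - \<gamma> - e) - e = 0" using \<gamma> by (simp add: algebra_simps)
    then have "b + e - \<gamma> \<in> {\<gamma>, \<delta>}" using assms(2) by blast
    with True show ?thesis by auto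
  next
    case False
    have "(\<gamma> - \<delta>) * (\<gamma> + \<delta> - (b + e)) = 0" using \<gamma> \<delta> by (simp add: algebra_simps)
    with False show ?thesis by simp
  qed
  then have \<delta>_eq: "\<delta> = b + e - \<gamma>" by simp
  show ?thesis using \<gamma> unfolding \<delta>_eq by (simp add: algebra_simps)
qed

text \<open>Eliminating the column of \<open>v\<close> gives
  \<open>p (X - c) = d (X - \<gamma>) (X - \<delta>)\<close> with \<open>c = 2 r + 1\<close>. Since
  \<open>c\<close> is not a root of the quadratic, \<open>X - c\<close> divides \<open>d\<close>,
  and the quotient is \<open>g\<close>.\<close>

lemma char_poly_pocket:
  assumes H: "pocket H v m r" and m: "m \<ge> 2"
    and hs: "distinct hs" "set hs = pverts H - {v}"
    and roots: "{x :: real. (x - (2 * real r + 1)) * (x - (real m - 1)) - (real m - 1) = 0} = {\<gamma>, \<delta>}"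
  obtains g where "g \<noteq> 0"
    "char_poly (list_mat (q_entry H) hs) = g * [:- (2 * real r + 1), 1:]"
    "Q_spectrum H = proots g + {#\<gamma>, \<delta>#}"
proof -
  interpret pair_graph H using H by (simp add: pocket_def)
  let ?c = "2 * real r + 1"
  define d where "d = char_poly (list_mat (q_entry H) hs)"
  define p where "p = char_poly (list_mat (q_entry H) ([v] @ hs))"
  have v: "v \<in> pverts H" using H by (simp add: pocket_def)
  have dist: "distinct ([v] @ hs)" "set ([v] @ hs) = pverts H" using hs v by auto
  have "length hs = m - 1"
    using hs H v distinct_card[OF hs(1)] by (simp add: pocket_def)
  then have len: "real (length hs) = real m - 1" using m by simp
  have deg_v: "real (out_degree (with_proj H) v) = real m - 1"
    using H m by (simp add: pocket_def)
  have loop: "adj H v v = 0" using no_loops' by (auto simp: adj_def)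
  have quad: "(x - ?c) * (x - (real m - 1)) - (real m - 1) = (x - \<gamma>) * (x - \<delta>)" for x
    by (rule pocket_quadratic_roots[OF _ roots]) (use m in simp)
  have "poly (p * [:- ?c, 1:]) x = poly (d * ([:- \<gamma>, 1:] * [:- \<delta>, 1:])) x" if x: "x \<noteq> ?c" for x
  proof -
    let ?M = "\<lambda>a b. (if a = b then x else 0) - q_entry H a b"
    let ?C = "\<lambda>z b. 1 / (x - ?c)"
    have clear: "?M y b + (\<Sum>z\<leftarrow>hs. ?M y z * ?C z b) = 0" if y: "y \<in> set hs" and b: "b \<in> set [v]" for y b
      unfolding sum_list_mult_const pocket_row_sum[OF H hs y]
      using x y b hs pocket_arcs(2)[OF H, of y] by (auto simp: q_entry_def)
    have "(\<Sum>z\<leftarrow>hs. ?M v z) = (\<Sum>z\<leftarrow>hs. - 1)"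
      using hs pocket_arcs(1)[OF H] by (intro arg_cong[where f = sum_list] map_cong) (auto simp: q_entry_def)
    then have vv: "?M v v + (\<Sum>z\<leftarrow>hs. ?M v z * ?C z v) = x - (real m - 1) - (real m - 1) / (x - ?c)"
      unfolding sum_list_mult_const using len loop deg_v by (simp add: q_entry_def sum_list_triv diff_divide_distrib)
    have "poly p x = det (list_mat (\<lambda>a b. ?M a b + (\<Sum>z\<leftarrow>hs. ?M a z * ?C z b)) [v]) * det (list_mat ?M hs)"
      unfolding p_def poly_char_poly_list_mat[OF dist(1)]
      by (rule det_list_mat_append) (rule clear)
    also have "det (list_mat ?M hs) = poly d x"
      unfolding d_def poly_char_poly_list_mat[OF hs(1)] ..
    also have "det (list_mat (\<lambda>a b. ?M a b + (\<Sum>z\<leftarrow>hs. ?M a z * ?C z b)) [v]) =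
        x - (real m - 1) - (real m - 1) / (x - ?c)"
      unfolding vv[symmetric] by (simp add: list_mat_def det_single)
    finally have "poly p x * (x - ?c) = poly d x * ((x - ?c) * (x - (real m - 1)) - (real m - 1))"
      using x by (simp add: field_simps)
    then show ?thesis unfolding quad by (simp add: algebra_simps)
  qed
  then have eq: "p * [:- ?c, 1:] = d * ([:- \<gamma>, 1:] * [:- \<delta>, 1:])"
    by (rule poly_eq_off_point)
  have "poly [:- ?c, 1:] ?c = 0" by simp
  then have "poly (d * ([:- \<gamma>, 1:] * [:- \<delta>, 1:])) ?c = 0"
    unfolding eq[symmetric] by (simp only: poly_mult mult_zero_right)
  then have "poly d ?c * ((?c - \<gamma>) * (?c - \<delta>)) = 0"
    by (simp del: mult_pCons_left mult_pCons_right mult_eq_0_iff)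
  \<comment> \<open>At \<open>?c\<close> the quadratic takes the value
    \<open>- (m - 1)\<close>.\<close>
  moreover have "(?c - \<gamma>) * (?c - \<delta>) \<noteq> 0"
    unfolding quad[of ?c, symmetric] using m by simp
  ultimately have "poly d ?c = 0" by simp
  then have "[:- ?c, 1:] dvd d" by (simp add: poly_eq_0_iff_dvd)
  then obtain g where g: "d = g * [:- ?c, 1:]" by (metis dvdE mult.commute)
  have "d \<noteq> 0"
    unfolding d_def using degree_monic_char_poly[OF list_mat_carrier, of "q_entry H" hs] by auto
  then have g0: "g \<noteq> 0" using g by auto
  have "p * [:- ?c, 1:] = g * ([:- \<gamma>, 1:] * [:- \<delta>, 1:]) * [:- ?c, 1:]"
    unfolding eq g by (simp only: ac_simps)
  then have "p = g * ([:- \<gamma>, 1:] * [:- \<delta>, 1:])"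
    by (rule mult_right_cancel[THEN iffD1, rotated]) simp
  then have "proots p = proots g + {#\<gamma>, \<delta>#}"
    using g0 by (simp add: proots_mult del: mult_pCons_left mult_pCons_right)
  moreover have "Q_spectrum H = proots p"
    unfolding p_def Q_spectrum_eq[OF dist] signless_laplacian_list_mat[OF dist(1)] ..
  ultimately show ?thesis using that[OF g0] g d_def by simp
qed

section \<open>The signless Laplacian of the graph with pockets\<close>

lemma pverts_graph_with_pockets:
  assumes "V \<subseteq> pverts F" "v \<in> pverts H"
  shows "pverts (graph_with_pockets F V H v) = Inl ` pverts F \<union> Inr ` (V \<times> (pverts H - {v}))"
  using assms by (auto simp: graph_with_pockets_def copy_vertex_def image_iff)

lemma adj_graph_with_pockets:
  assumes "pair_graph H"
  shows "adj (graph_with_pockets F V H v) (Inl a) (Inl b) = adj F a b"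
    "w \<in> V \<Longrightarrow> h \<noteq> v \<Longrightarrow>
      adj (graph_with_pockets F V H v) (Inl a) (Inr (w, h)) = (if a = w then adj H v h else 0)"
    "w \<in> V \<Longrightarrow> h \<noteq> v \<Longrightarrow>
      adj (graph_with_pockets F V H v) (Inr (w, h)) (Inl b) = (if w = b then adj H h v else 0)"
    "w \<in> V \<Longrightarrow> h \<noteq> v \<Longrightarrow> h' \<noteq> v \<Longrightarrow>
      adj (graph_with_pockets F V H v) (Inr (w, h)) (Inr (w', h')) = (if w = w' then adj H h h' else 0)"
proof -
  interpret pair_graph H by fact
  \<comment> \<open>A copy could add an arc between vertices of \<open>F\<close> only through a loop
    at \<open>v\<close>.\<close>
  have loop: "(v, v) \<notin> parcs H" using no_loops' by blast
  have arcs: "e \<in> parcs (graph_with_pockets F V H v) \<longleftrightarrow>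
      (\<exists>x y. (x, y) \<in> parcs F \<and> e = (Inl x, Inl y)) \<or>
      (\<exists>w\<in>V. \<exists>x y. (x, y) \<in> parcs H \<and> e = (copy_vertex v w x, copy_vertex v w y))" for e
    by (auto simp: graph_with_pockets_def) blast
  show "adj (graph_with_pockets F V H v) (Inl a) (Inl b) = adj F a b"
    "w \<in> V \<Longrightarrow> h \<noteq> v \<Longrightarrow>
      adj (graph_with_pockets F V H v) (Inl a) (Inr (w, h)) = (if a = w then adj H v h else 0)"
    "w \<in> V \<Longrightarrow> h \<noteq> v \<Longrightarrow>
      adj (graph_with_pockets F V H v) (Inr (w, h)) (Inl b) = (if w = b then adj H h v else 0)"
    "w \<in> V \<Longrightarrow> h \<noteq> v \<Longrightarrow> h' \<noteq> v \<Longrightarrow>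
      adj (graph_with_pockets F V H v) (Inr (w, h)) (Inr (w', h')) = (if w = w' then adj H h h' else 0)"
    unfolding adj_def arcs copy_vertex_def using loop by (auto split: if_splits)
qed

lemma out_degree_graph_with_pockets:
  assumes F: "pair_graph F" and V: "V \<subseteq> pverts F" and H: "pocket H v m r"
  shows "a \<in> pverts F \<Longrightarrow> real (out_degree (with_proj (graph_with_pockets F V H v)) (Inl a)) =
      real (out_degree (with_proj F) a) + (if a \<in> V then real (card (pverts H - {v})) else 0)"
    and "w \<in> V \<Longrightarrow> h \<in> pverts H - {v} \<Longrightarrow>
      real (out_degree (with_proj (graph_with_pockets F V H v)) (Inr (w, h))) = real r + 1"
proof -
  interpret F: pair_graph F by fact
  have H': "pair_graph H" and v: "v \<in> pverts H" using H by (simp_all add: pocket_def)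
  interpret H: pair_graph H by fact
  let ?G = "graph_with_pockets F V H v" and ?S = "pverts H - {v}"
  have G: "pair_graph ?G" by (rule pair_graph_graph_with_pockets[OF F H' V])
  have fin: "finite (pverts F)" "finite V" "finite ?S"
    using F.pair_finite_verts H.pair_finite_verts finite_subset[OF V] by auto
  \<comment> \<open>Row sums are split into the part over \<open>F\<close> and one part for each
    copy of \<open>H - v\<close>; at most one copy contributes to each row.\<close>
  have sum: "(\<Sum>y\<in>pverts ?G. f y) = (\<Sum>b\<in>pverts F. f (Inl b)) + (\<Sum>w\<in>V. \<Sum>h\<in>?S. f (Inr (w, h)))"
    for f :: "'a + 'a \<times> 'b \<Rightarrow> real"
    unfolding pverts_graph_with_pockets[OF V v] using fin
    by (subst sum.union_disjoint) (auto simp: sum.reindex sum.cartesian_product split_beta)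
  note adj = adj_graph_with_pockets[OF H']
  show "real (out_degree (with_proj ?G) (Inl a)) =
      real (out_degree (with_proj F) a) + (if a \<in> V then real (card ?S) else 0)" if "a \<in> pverts F"
  proof -
    have "(\<Sum>w\<in>V. \<Sum>h\<in>?S. adj ?G (Inl a) (Inr (w, h))) = (\<Sum>w\<in>V. if a = w then real (card ?S) else 0)"
      using pocket_arcs(1)[OF H] by (intro sum.cong) (auto simp: adj)
    then show ?thesis
      unfolding real_out_degree[OF G] real_out_degree[OF F] sum using fin by (simp add: adj)
  qed
  show "real (out_degree (with_proj ?G) (Inr (w, h))) = real r + 1" if w: "w \<in> V" and h: "h \<in> ?S"
  proof -
    have "(\<Sum>w'\<in>V. \<Sum>h'\<in>?S. adj ?G (Inr (w, h)) (Inr (w', h'))) =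
        (\<Sum>w'\<in>V. if w = w' then real r else 0)"
      using pocket_regular(1)[OF H, of h] w h by (intro sum.cong) (auto simp: adj)
    moreover have "(\<Sum>b\<in>pverts F. adj ?G (Inr (w, h)) (Inl b)) = (\<Sum>b\<in>pverts F. if w = b then 1 else 0)"
      using pocket_arcs(2)[OF H, of h] w h by (intro sum.cong) (auto simp: adj)
    ultimately show ?thesis
      unfolding real_out_degree[OF G] sum using fin w V by auto
  qed
qed

text \<open>The block of \<open>F\<close> in the signless Laplacian of the whole graph: a vertex in
  \<open>V\<close> gains \<open>m - 1\<close> neighbours from its copy.\<close>

definition pocket_base :: "'f pair_pre_digraph \<Rightarrow> 'f set \<Rightarrow> nat \<Rightarrow> 'f \<Rightarrow> 'f \<Rightarrow> real" where
  "pocket_base F V m a b = q_entry F a b + (if a = b \<and> a \<in> V then real m - 1 else 0)"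

lemma q_entry_graph_with_pockets:
  assumes F: "pair_graph F" and V: "V \<subseteq> pverts F" and H: "pocket H v m r" and m: "m \<ge> 2"
    and a: "a \<in> pverts (graph_with_pockets F V H v)" and b: "b \<in> pverts (graph_with_pockets F V H v)"
  shows "q_entry (graph_with_pockets F V H v) a b =
    pocket_entry (pocket_base F V m) (q_entry H) (\<lambda>_. 1) (\<lambda>_. 1) a b"
proof -
  have H': "pair_graph H" and v: "v \<in> pverts H" using H by (simp_all add: pocket_def)
  interpret H: pair_graph H by fact
  have "card (pverts H - {v}) = m - 1" using H v by (simp add: pocket_def)
  then have card: "real (card (pverts H - {v})) = real m - 1" using m by simp
  note [simp] = adj_graph_with_pockets[OF H'] out_degree_graph_with_pockets[OF F V H] card
    pocket_arcs[OF H] pocket_regular[OF H]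
  consider x where "x \<in> pverts F" "a = Inl x" | w h where "w \<in> V" "h \<in> pverts H" "h \<noteq> v" "a = Inr (w, h)"
    using a unfolding pverts_graph_with_pockets[OF V v] by auto
  then show ?thesis
  proof cases
    case 1
    then show ?thesis
      using b unfolding pverts_graph_with_pockets[OF V v] by (auto simp: q_entry_def pocket_base_def split: if_splits)
  next
    case 2
    then show ?thesis
      using b unfolding pverts_graph_with_pockets[OF V v] by (auto simp: q_entry_def split: if_splits)
  qed
qed

section \<open>Factoring the characteristic polynomial\<close>

text \<open>The characteristic matrix again has pocket structure, with negated couplings, so
  \<open>det_pocket_entry\<close> applies to it.\<close>

lemma pocket_entry_char:
  "(if a = b then x else 0) - pocket_entry P D u l a b =
    pocket_entry (\<lambda>a b. (if a = b then x else 0) - P a b) (\<lambda>a b. (if a = b then x else 0) - D a b)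
      (\<lambda>h. - u h) (\<lambda>h. - l h) a (b :: 'f + 'f \<times> 'c)" for x :: "'b :: field"
  by (cases a; cases b) (auto split: if_splits)

lemma poly_char_poly_pocket_entry:
  fixes x :: "'b :: field"
  assumes "distinct xs" "distinct vs" "distinct hs" "s \<noteq> 0"
    and "\<And>h. h \<in> set hs \<Longrightarrow> (\<Sum>z\<leftarrow>hs. (if h = z then x else 0) - D h z) = s"
  shows "poly (char_poly (list_mat (pocket_entry P D u (\<lambda>_. 1)) (pocket_list xs vs hs))) x =
    poly (char_poly (list_mat D hs)) x ^ length vs *
    det (list_mat (\<lambda>a b. (if a = b then x else 0) - P a b
      - (if a = b \<and> a \<in> set vs then (\<Sum>z\<leftarrow>hs. u z) / s else 0)) xs)"
proof -
  \<comment> \<open>Here the constant \<open>c\<close> of \<open>det_pocket_entry\<close> is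
    \<open>- 1\<close>, and its sign cancels that of \<open>- u\<close>.\<close>
  have "- 1 * (\<Sum>z\<leftarrow>hs. - u z) / s = (\<Sum>z\<leftarrow>hs. u z) / s" by (simp add: uminus_sum_list_map o_def)
  then show ?thesis
    unfolding poly_char_poly_list_mat[OF distinct_pocket_list[OF assms(1,2,3)]]
      poly_char_poly_list_mat[OF assms(3)] pocket_entry_char
    by (subst det_pocket_entry[OF assms(4,5) refl assms(2)]) (simp_all only:)
qed

text \<open>The quotient matrix of \<open>Q(G[F, V, H])\<close> for the partition whose classes are the vertices of \<open>F\<close>
  and the copies of \<open>H - v\<close>.\<close>

definition pocket_quotient :: "'f pair_pre_digraph \<Rightarrow> 'f list \<Rightarrow> 'f list \<Rightarrow> nat \<Rightarrow> nat \<Rightarrow> real mat" where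
  "pocket_quotient F xs vs m r = list_mat
    (pocket_entry (pocket_base F (set vs) m) (\<lambda>_ _. 2 * real r + 1) (\<lambda>_. real m - 1) (\<lambda>_. 1))
    (pocket_list xs vs [()])"

text \<open>Elimination in the full matrix and in the quotient matrix leaves the same determinant
  over \<open>F\<close>. The copies contribute \<open>(g (X - c)) ^ k\<close> in one case and
  \<open>(X - c) ^ k\<close> in the other, where \<open>k = length vs\<close>, so the characteristic
  polynomials differ by the factor \<open>g ^ k\<close>.\<close>

lemma Q_spectrum_graph_with_pockets:
  assumes F: "pair_graph F" and H: "pocket H v m r" and m: "m \<ge> 2"
    and hs: "distinct hs" "set hs = pverts H - {v}"
    and xs: "distinct xs" "set xs = pverts F" and vs: "distinct vs" "set vs \<subseteq> pverts F"
    and g: "g \<noteq> 0" "char_poly (list_mat (q_entry H) hs) = g * [:- (2 * real r + 1), 1:]"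
  shows "Q_spectrum (graph_with_pockets F (set vs) H v) =
    repeat_mset (length vs) (proots g) + proots (char_poly (pocket_quotient F xs vs m r))"
proof -
  have v: "v \<in> pverts H" using H by (simp add: pocket_def)
  let ?G = "graph_with_pockets F (set vs) H v" and ?c = "2 * real r + 1"
  let ?ys = "pocket_list xs vs hs"
  let ?E = "pocket_entry (pocket_base F (set vs) m) (q_entry H) (\<lambda>_. 1) (\<lambda>_. 1)"
  have ys: "distinct ?ys" "set ?ys = pverts ?G"
    using distinct_pocket_list[OF xs(1) vs(1) hs(1)] pverts_graph_with_pockets[OF vs(2) v] xs hs
    by (simp_all add: set_pocket_list)
  have "length hs = m - 1"
    using hs H v distinct_card[OF hs(1)] by (simp add: pocket_def)
  then have len: "(\<Sum>z\<leftarrow>hs. 1) = real m - 1" using m by (simp add: sum_list_triv)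
  have Q: "signless_laplacian ?G ?ys = list_mat ?E ?ys"
    unfolding signless_laplacian_list_mat[OF ys(1)]
    using q_entry_graph_with_pockets[OF F vs(2) H m] ys(2) by (intro list_mat_cong) simp
  have "char_poly (list_mat ?E ?ys) = g ^ length vs * char_poly (pocket_quotient F xs vs m r)"
  proof (rule poly_eq_off_point)
    fix x assume x: "x \<noteq> ?c"
    \<comment> \<open>The correction agrees in both cases: \<open>m - 1\<close> couplings equal to 1
      for \<open>H - v\<close>, one coupling equal to \<open>m - 1\<close> for the quotient.\<close>
    let ?R = "det (list_mat (\<lambda>a b. (if a = b then x else 0) - pocket_base F (set vs) m a b
      - (if a = b \<and> a \<in> set vs then (real m - 1) / (x - ?c) else 0)) xs)"
    have s: "x - ?c \<noteq> 0" and lin: "poly [:- ?c, 1:] x = x - ?c" using x by simp_all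
    have "poly (char_poly (list_mat ?E ?ys)) x = (poly g x * (x - ?c)) ^ length vs * ?R"
      using poly_char_poly_pocket_entry[OF xs(1) vs(1) hs(1) s pocket_row_sum[OF H hs],
          of "pocket_base F (set vs) m" "\<lambda>_. 1"]
      unfolding g(2) len poly_mult lin .
    moreover have "poly (char_poly (pocket_quotient F xs vs m r)) x = (x - ?c) ^ length vs * ?R"
    proof -
      have "(\<Sum>z\<leftarrow>[()]. real m - 1) = real m - 1" by simp
      moreover have "poly (char_poly (list_mat (\<lambda>_ _. ?c) [()])) x = x - ?c"
        by (simp add: poly_char_poly_list_mat) (simp add: list_mat_def det_single)
      moreover have "(\<Sum>z\<leftarrow>[()]. (if h = z then x else 0) - ?c) = x - ?c" for h by simp
      ultimately show ?thesis
        unfolding pocket_quotient_def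
        using poly_char_poly_pocket_entry[OF xs(1) vs(1) _ s, where hs = "[()]"
            and D = "\<lambda>_ _. ?c" and x = x and P = "pocket_base F (set vs) m" and u = "\<lambda>_. real m - 1"]
        by (simp only: distinct_singleton simp_thms)
    qed
    ultimately show "poly (char_poly (list_mat ?E ?ys)) x =
        poly (g ^ length vs * char_poly (pocket_quotient F xs vs m r)) x"
      by (simp only: poly_mult poly_power power_mult_distrib mult.assoc)
  qed
  \<comment> \<open>Root multisets of products add up only for nonzero factors.\<close>
  moreover have "char_poly (pocket_quotient F xs vs m r) \<noteq> 0"
    unfolding pocket_quotient_def using degree_monic_char_poly[OF list_mat_carrier]
    by (metis coeff_0 zero_neq_one)
  ultimately show ?thesis
    using g(1) unfolding Q_spectrum_eq[OF ys] Q by (simp add: proots_mult proots_power)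
qed

lemma Q_spectrum_pocket_decomposition:
  assumes F: "pair_graph F" and H: "pocket H v m r" and m: "m \<ge> 2"
    and xs: "distinct xs" "set xs = pverts F" and vs: "distinct vs" "set vs \<subseteq> pverts F"
    and roots: "{x :: real. (x - 2 * real r - 1) * (x - real m + 1) - real m + 1 = 0} = {\<gamma>, \<delta>}"
  shows "Q_spectrum H = pocket_eigenvalues H \<gamma> \<delta> + {#\<gamma>, \<delta>#}"
    and "Q_spectrum (graph_with_pockets F (set vs) H v) =
      repeat_mset (length vs) (pocket_eigenvalues H \<gamma> \<delta>)
      + proots (char_poly (pocket_quotient F xs vs m r))"
proof -
  interpret pair_graph H using H by (simp add: pocket_def)
  have "(x - (2 * real r + 1)) * (x - (real m - 1)) - (real m - 1) =
      (x - 2 * real r - 1) * (x - real m + 1) - real m + 1" for x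
    by (simp add: algebra_simps)
  then have roots': "{x. (x - (2 * real r + 1)) * (x - (real m - 1)) - (real m - 1) = 0} = {\<gamma>, \<delta>}"
    using roots by (simp only:)
  obtain hs where hs: "distinct hs" "set hs = pverts H - {v}"
    using finite_distinct_list[of "pverts H - {v}"] by auto
  obtain g where g: "g \<noteq> 0" "char_poly (list_mat (q_entry H) hs) = g * [:- (2 * real r + 1), 1:]"
    "Q_spectrum H = proots g + {#\<gamma>, \<delta>#}"
    using char_poly_pocket[OF H m hs roots'] .
  \<comment> \<open>The pair \<open>{#\<gamma>, \<delta>#}\<close> is contained in the spectrum of
    \<open>H\<close>, so the multiset difference truncates nothing.\<close>
  have eig: "pocket_eigenvalues H \<gamma> \<delta> = proots g" unfolding pocket_eigenvalues_def g(3) by simp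
  show "Q_spectrum H = pocket_eigenvalues H \<gamma> \<delta> + {#\<gamma>, \<delta>#}" using g(3) eig by simp
  show "Q_spectrum (graph_with_pockets F (set vs) H v) =
      repeat_mset (length vs) (pocket_eigenvalues H \<gamma> \<delta>)
      + proots (char_poly (pocket_quotient F xs vs m r))"
    unfolding eig by (rule Q_spectrum_graph_with_pockets[OF F H m hs xs vs g(1,2)])
qed

section \<open>Multiplicities, number and independence of the eigenvalues\<close>

theorem theorem3p6:
  fixes F :: "'f pair_pre_digraph" and V :: "'f set" and n k m r1 :: nat
    and H :: "'h pair_pre_digraph" and v :: 'h
    and H' :: "'g pair_pre_digraph" and v' :: 'g
    and \<gamma> \<delta> :: real
  assumes "pair_graph F" and "card (pverts F) = n" and "n \<ge> 1"
    and "V \<subseteq> pverts F" and "card V = k"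
    and "m \<ge> 2" and "r1 \<ge> 1" and "pocket H v m r1"
    and "{x :: real. (x - 2 * real r1 - 1) * (x - real m + 1) - real m + 1 = 0} = {\<gamma>, \<delta>}"
  shows "(\<forall>q \<in># pocket_eigenvalues H \<gamma> \<delta>.
            count (Q_spectrum (graph_with_pockets F V H v)) q
              = k * count (pocket_eigenvalues H \<gamma> \<delta>) q
                + count (remaining_eigenvalues F V H v \<gamma> \<delta>) q) \<and>
         size (remaining_eigenvalues F V H v \<gamma> \<delta>) = n + k \<and>
         (pocket H' v' m r1 \<longrightarrow>
            remaining_eigenvalues F V H' v' \<gamma> \<delta> = remaining_eigenvalues F V H v \<gamma> \<delta>)"
proof -
  interpret F: pair_graph F by fact
  have fin: "finite V" by (rule finite_subset[OF assms(4) F.pair_finite_verts])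
  then obtain vs where vs: "distinct vs" "set vs = V" using finite_distinct_list by blast
  have k: "length vs = k" using distinct_card[OF vs(1)] vs(2) assms(5) by simp
  obtain xs where xs: "distinct xs" "set xs = pverts F"
    using finite_distinct_list[OF F.pair_finite_verts] by blast
  have V: "set vs \<subseteq> pverts F" using vs(2) assms(4) by simp
  let ?R = "proots (char_poly (pocket_quotient F xs vs m r1))" and ?G = "graph_with_pockets F V H v"
  note decomp = Q_spectrum_pocket_decomposition[OF assms(1) _ assms(6) xs vs(1) V assms(9), unfolded vs(2) k]
  have rem: "remaining_eigenvalues F V H v \<gamma> \<delta> = ?R"
    unfolding remaining_eigenvalues_def decomp(2)[OF assms(8)] assms(5) by simp
  \<comment> \<open>\<open>?R\<close> does not mention \<open>H\<close>, so every pocket with the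
    same \<open>m\<close> and \<open>r1\<close> leaves the same multiset; this is the independence
    claim.\<close>
  have rem': "remaining_eigenvalues F V H' v' \<gamma> \<delta> = ?R" if "pocket H' v' m r1"
    unfolding remaining_eigenvalues_def decomp(2)[OF that] assms(5) by simp
  have H: "pair_graph H" "v \<in> pverts H" "card (pverts H) = m" using assms(8) by (simp_all add: pocket_def)
  interpret H: pair_graph H by (rule H(1))
  have "card (pverts ?G) = n + k * (m - 1)"
    unfolding pverts_graph_with_pockets[OF assms(4) H(2)]
    using fin H assms(2,5) F.pair_finite_verts
    by (subst card_Un_disjoint) (auto simp: card_image card_cartesian_product)
  \<comment> \<open>The quotient matrix is in general not symmetric, so the size of
    \<open>?R\<close> is found by comparing orders: with \<open>m - 2\<close> pocket eigenvalues,
    \<open>n + k (m - 1) - k (m - 2) = n + k\<close>.\<close>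
  then have "k * size (pocket_eigenvalues H \<gamma> \<delta>) + size ?R = n + k * (m - 1)"
    using size_Q_spectrum[OF pair_graph_graph_with_pockets[OF assms(1) H(1) assms(4), of v]]
    unfolding decomp(2)[OF assms(8)] by simp
  moreover have "m = size (pocket_eigenvalues H \<gamma> \<delta>) + 2"
    using size_Q_spectrum[OF H(1)] H(3) unfolding decomp(1)[OF assms(8)] by simp
  ultimately have "size ?R = n + k" by simp
  then show ?thesis
    unfolding rem using rem' decomp(2)[OF assms(8)] by simp
qed

end
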